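(* For every positive integer $k$, the graphs $B_k+v_1v_3$ and $B_k+v_2v_4$ are $\mathcal D^L$-cospectral, and both are bipartite.
   Context: For $k\in\mathbb Z_+$, $B_k$ is the graph with vertex set $\{v_0,v_1,v_2,v_3,v_4\}\cup L\cup R$, where $|L|=k$ and $|R|=k+1$ (all these sets disjoint), and edge set consisting of $v_0v_1$, $v_0v_2$, $v_2v_3$, the edges $v_0\ell$ for every $\ell\in L$, and the edges $rv_0$, $rv_3$, $rv_4$ for every $r\in R$ (no other edges). $G+xy$ denotes $G$ with edge $xy$ added. For a connected graph $G$ with vertices $w_1,\dots,w_n$, $d(u,v)$ is the length of a shortest $u,v$-path, $t(v)=\sum_w d(v,w)$, $\mathcal D(G)$ has $(i,j)$-entry $d(w_i,w_j)$, and the distance Laplacian is $\mathcal D^L(G)=\operatorname{diag}(t(w_1),\dots,t(w_n))-\mathcal D(G)$. Nonisomorphic graphs are $\mathcal D^L$-cospectral if their distance Laplacian matrices have the same spectrum. *)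

theory Defs
  imports
    "Graph_Theory.Digraph_Component"
    "Graph_Theory.Digraph_Isomorphism"
    "Jordan_Normal_Form.Char_Poly"
    Complex_Main
begin

text \<open>
  A finite simple graph is a \<^locale>\<open>pair_graph\<close>, that is, a finite, loop-free digraph without
  parallel arcs whose arc set is symmetric: the undirected edge \<open>xy\<close> is the pair of arcs
  \<open>(x, y)\<close> and \<open>(y, x)\<close>.
\<close>

definition add_edge :: "'a pair_pre_digraph \<Rightarrow> 'a \<Rightarrow> 'a \<Rightarrow> 'a pair_pre_digraph" where
  "add_edge G x y = \<lparr>pverts = pverts G, parcs = parcs G \<union> {(x, y), (y, x)}\<rparr>"

definition bipartite :: "'a pair_pre_digraph \<Rightarrow> bool" where
  "bipartite G \<longleftrightarrow>
     (\<exists>X Y. pverts G = X \<union> Y \<and> X \<inter> Y = {} \<and> parcs G \<subseteq> X \<times> Y \<union> Y \<times> X)"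

text \<open>Only meaningful if \<open>v\<close> is reachable from \<open>u\<close>; the value is arbitrary otherwise.\<close>

definition graph_dist :: "'a pair_pre_digraph \<Rightarrow> 'a \<Rightarrow> 'a \<Rightarrow> nat" where
  "graph_dist G u v = (LEAST n. \<exists>p. pre_digraph.apath (with_proj G) u p v \<and> length p = n)"

definition transmission :: "'a pair_pre_digraph \<Rightarrow> 'a \<Rightarrow> nat" where
  "transmission G v = (\<Sum>w\<in>pverts G. graph_dist G v w)"

text \<open>The matrices depend on an enumeration \<open>ws\<close> of the vertices.\<close>

definition vertex_enum :: "'a pair_pre_digraph \<Rightarrow> 'a list \<Rightarrow> bool" where
  "vertex_enum G ws \<longleftrightarrow> distinct ws \<and> set ws = pverts G"

definition dist_matrix :: "'a pair_pre_digraph \<Rightarrow> 'a list \<Rightarrow> real mat" where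
  "dist_matrix G ws =
     mat (length ws) (length ws) (\<lambda>(i, j). real (graph_dist G (ws ! i) (ws ! j)))"

definition dist_laplacian :: "'a pair_pre_digraph \<Rightarrow> 'a list \<Rightarrow> real mat" where
  "dist_laplacian G ws =
     mat_diag (length ws) (\<lambda>i. real (transmission G (ws ! i))) - dist_matrix G ws"

text \<open>
  The spectrum is the multiset of complex eigenvalues, counted with algebraic multiplicity
  (the library's \<open>spectrum\<close> is only the set of eigenvalues).
\<close>

definition spectrum_mset :: "real mat \<Rightarrow> complex multiset" where
  "spectrum_mset A = proots (char_poly (map_mat complex_of_real A))"

text \<open>
  Another enumeration of the vertices conjugates the matrix by a permutation, which
  leaves the spectrum unchanged; so quantifying over all enumerations is no extra demand.
\<close>

definition DL_cospectral :: "'a pair_pre_digraph \<Rightarrow> 'b pair_pre_digraph \<Rightarrow> bool" where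
  "DL_cospectral G H \<longleftrightarrow>
     pair_graph G \<and> connected (with_proj G) \<and>
     pair_graph H \<and> connected (with_proj H) \<and>
     \<not> digraph_iso (with_proj G) (with_proj H) \<and>
     (\<forall>ws us. vertex_enum G ws \<longrightarrow> vertex_enum H us \<longrightarrow>
        spectrum_mset (dist_laplacian G ws) = spectrum_mset (dist_laplacian H us))"

datatype vertex = V0 | V1 | V2 | V3 | V4 | VL nat | VR nat

definition L_verts :: "nat \<Rightarrow> vertex set" where
  "L_verts k = VL ` {..<k}"

definition R_verts :: "nat \<Rightarrow> vertex set" where
  "R_verts k = VR ` {..<k + 1}"

definition B_graph :: "nat \<Rightarrow> vertex pair_pre_digraph" where
  "B_graph k =
     \<lparr>pverts = {V0, V1, V2, V3, V4} \<union> L_verts k \<union> R_verts k,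
      parcs = symcl ({(V0, V1), (V0, V2), (V2, V3)} \<union> {V0} \<times> L_verts k
                       \<union> R_verts k \<times> {V0, V3, V4})\<rparr>"

end

theory Submission
  imports Defs
begin

text \<open>
  Both graphs are bipartite with sides \<open>{v0, v3, v4}\<close> and the rest, and \<open>v0 r\<close> (with \<open>r \<in> R\<close>) is an
  edge whose ends together dominate the graph. Hence all distances are 0, 1, 2 or 3, and the two
  distance matrices differ only at the pairs \<open>v1 v3\<close> and \<open>v2 v4\<close>. An orthogonal involution
  that is the identity outside \<open>v1, v2, v3, v4\<close> then conjugates one distance Laplacian into the
  other. The graphs are not isomorphic, as \<open>v1\<close> has degree 2 in the first graph while the second
  graph has no vertex of degree 2.
\<close>

section \<open>Certifying graph distances by a potential function\<close>

text \<open>Since \<open>f\<close> grows by at most 1 along an arc, no walk from \<open>u\<close> to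
  \<open>y\<close> is shorter than \<open>f y\<close>. Descending through the predecessors of
  \<open>pred\<close> reaches \<open>u\<close> and yields a walk of exactly that length.\<close>

lemma (in pair_wf_digraph) graph_dist_eqI:
  fixes f :: "'a \<Rightarrow> nat"
  assumes u: "u \<in> pverts G" and v: "v \<in> pverts G" and "f u = 0"
    and lip: "\<And>x y. (x, y) \<in> parcs G \<Longrightarrow> f y \<le> f x + 1"
    and pred: "\<And>y. y \<in> pverts G \<Longrightarrow> y \<noteq> u \<Longrightarrow> \<exists>x. (x, y) \<in> parcs G \<and> f y = f x + 1"
  shows "u \<rightarrow>\<^sup>*\<^bsub>with_proj G\<^esub> v" and "graph_dist G u v = f v"
proof -
  have walk: "\<exists>p. awalk u p y \<and> length p = f y" if "y \<in> pverts G" for y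
    using that
  proof (induction "f y" arbitrary: y rule: less_induct)
    case less
    show ?case
    proof (cases "y = u")
      case True
      then show ?thesis using u \<open>f u = 0\<close> by (intro exI[of _ "[]"]) (simp add: awalk_Nil_iff)
    next
      case False
      from pred[OF less.prems this] obtain x where x: "(x, y) \<in> parcs G" "f y = f x + 1" by blast
      with less.hyps[of x] in_arcsD1[OF x(1)] obtain p where "awalk u p x" "length p = f x" by auto
      moreover have "awalk x [(x, y)] y"
        using x(1) in_arcsD1[OF x(1)] in_arcsD2[OF x(1)] by (simp add: awalk_def)
      ultimately show ?thesis
        using x(2) by (intro exI[of _ "p @ [(x, y)]"]) (auto intro: awalk_appendI simp del: awalk_append_iff)
    qed
  qed
  have lower: "f y \<le> f x + length p" if "awalk x p y" for x p y
    using that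
  proof (induction p arbitrary: x)
    case Nil
    then show ?case by (simp add: awalk_Nil_iff)
  next
    case (Cons e p)
    then show ?case using lip[of "fst e" "snd e"] by (fastforce simp: awalk_Cons_iff)
  qed
  obtain p where p: "awalk u p v" "length p = f v" using walk v by blast
  then show "u \<rightarrow>\<^sup>*\<^bsub>with_proj G\<^esub> v" by (auto simp: reachable_awalk)
  \<comment> \<open>\<open>graph_dist\<close> minimises over paths, so the walk must not repeat a
    vertex. A repetition would allow a closed subwalk to be cut out, leaving a walk shorter than the
    lower bound.\<close>
  have "distinct (awalk_verts u p)"
  proof (rule ccontr)
    assume nd: "\<not> distinct (awalk_verts u p)"
    obtain q r s where "awalk_cyc_decomp p = (q, r, s)" by (metis prod_cases3)
    from awalk_cyc_decompE[OF this p(1) nd] obtain w where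
      "p = q @ r @ s" "awalk u q w" "awalk w s v" "closed_w r" by metis
    then have "awalk u (q @ s) v" "length (q @ s) < length p"
      by (auto intro: awalk_appendI simp: closed_w_def simp del: awalk_append_iff)
    with lower[of u "q @ s" v] p \<open>f u = 0\<close> show False by simp
  qed
  with p have "apath u p v" by (simp add: apath_def)
  moreover have "f v \<le> length q" if "apath u q v" for q
    using lower[of u q v] that \<open>f u = 0\<close> by (simp add: apath_def)
  ultimately show "graph_dist G u v = f v"
    unfolding graph_dist_def using p(2) by (intro Least_equality) auto
qed

section \<open>Distances in a bipartite graph with a dominating edge\<close>

context pair_graph begin

text \<open>The edge \<open>x0 y0\<close> dominates the graph, so opposite vertices are joined through it
  by a path of length 3.\<close>

context
  fixes X :: "'a set" and x0 y0 :: 'a and d :: "'a \<Rightarrow> 'a \<Rightarrow> nat"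
  assumes bip: "\<And>x y. (x, y) \<in> parcs G \<Longrightarrow> x \<in> X \<longleftrightarrow> y \<notin> X"
    and x0: "x0 \<in> X" and y0: "y0 \<notin> X"
    and dom_x0: "\<And>y. y \<in> pverts G \<Longrightarrow> y \<notin> X \<Longrightarrow> (x0, y) \<in> parcs G"
    and dom_y0: "\<And>x. x \<in> pverts G \<Longrightarrow> x \<in> X \<Longrightarrow> (y0, x) \<in> parcs G"
    and d_def: "\<And>u v. d u v = (if u = v then 0 else if (u, v) \<in> parcs G then 1
                 else if u \<in> X \<longleftrightarrow> v \<in> X then 2 else 3)"
begin

lemma dominating_edge_dist:
  assumes u: "u \<in> pverts G" and v: "v \<in> pverts G"
  shows "u \<rightarrow>\<^sup>*\<^bsub>with_proj G\<^esub> v" and "graph_dist G u v = d u v"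
proof -
  have sym: "(x, y) \<in> parcs G \<longleftrightarrow> (y, x) \<in> parcs G" for x y
    using pair_sym_arcs by (auto simp: symmetric_def sym_def)
  have "d u u = 0" by (simp add: d_def)
  \<comment> \<open>The ends of an arc lie on opposite sides, so \<open>d u\<close> changes parity
    along it. The only excessive increase left is from 0 to 3, but \<open>d u x = 0\<close> means
    \<open>x = u\<close>, and then \<open>y\<close> is a neighbour of \<open>u\<close>.\<close>
  moreover have "d u y \<le> d u x + 1" if "(x, y) \<in> parcs G" for x y
    using bip[OF that] that bip[of u x] bip[of u y] by (auto simp: d_def)
  moreover have "\<exists>x. (x, y) \<in> parcs G \<and> d u y = d u x + 1" if y: "y \<in> pverts G" "y \<noteq> u" for y
  proof -
    consider "(u, y) \<in> parcs G" | "(u, y) \<notin> parcs G" "u \<in> X" "y \<in> X"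
      | "(u, y) \<notin> parcs G" "u \<notin> X" "y \<notin> X" | "(u, y) \<notin> parcs G" "u \<in> X" "y \<notin> X"
      | "(u, y) \<notin> parcs G" "u \<notin> X" "y \<in> X" by blast
    then show ?thesis
    proof cases
      case 1
      then show ?thesis using y by (intro exI[of _ u]) (auto simp: d_def)
    next
      case 2
      then show ?thesis using y u y0 dom_y0[of u] dom_y0[of y] sym[of u y0]
        by (intro exI[of _ y0]) (auto simp: d_def)
    next
      case 3
      then show ?thesis using y u x0 dom_x0[of u] dom_x0[of y] sym[of u x0]
        by (intro exI[of _ x0]) (auto simp: d_def)
    next
      \<comment> \<open>The predecessor \<open>x0\<close> is at distance 2 from \<open>u\<close>: it
        lies on the side of \<open>u\<close>, and it differs from \<open>u\<close> because it is
        adjacent to \<open>y\<close>. The path is \<open>u\<close>, \<open>y0\<close>,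
        \<open>x0\<close>, \<open>y\<close>.\<close>
      case 4
      then have "u \<noteq> x0" "(u, x0) \<notin> parcs G" using y dom_x0[of y] x0 bip[of u x0] by auto
      then show ?thesis using 4 y x0 dom_x0[of y]
        by (intro exI[of _ x0]) (auto simp: d_def)
    next
      case 5
      then have "u \<noteq> y0" "(u, y0) \<notin> parcs G" using y dom_y0[of y] y0 bip[of u y0] by auto
      then show ?thesis using 5 y y0 dom_y0[of y]
        by (intro exI[of _ y0]) (auto simp: d_def)
    qed
  qed
  ultimately show "u \<rightarrow>\<^sup>*\<^bsub>with_proj G\<^esub> v" "graph_dist G u v = d u v"
    using graph_dist_eqI[OF u v, of "d u"] by auto
qed

lemma dominating_edge_connected:
  assumes "pverts G \<noteq> {}"
  shows "connected (with_proj G)"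
proof (rule connectedI)
  show "u \<rightarrow>\<^sup>*\<^bsub>mk_symmetric (with_proj G)\<^esub> v"
    if "u \<in> pverts G" "v \<in> pverts G" for u v
    using that dominating_edge_dist(1) by (auto intro: reachable_mk_symmetricI)
qed (use assms in auto)

end

end

section \<open>Isomorphisms and neighbourhoods\<close>

text \<open>An isomorphism carries separate maps for vertices, arcs, tails and heads. As the target
  is again of the form \<open>with_proj H\<close>, its tails and heads are \<open>fst\<close> and
  \<open>snd\<close>, so the vertex map \<open>\<phi>\<close> determines the arc map. The witness
  \<open>w\<close> is \<open>\<phi> v\<close>.\<close>

lemma digraph_iso_neighbours:
  assumes iso: "digraph_iso (with_proj G) (with_proj H)" and v: "v \<in> pverts G"
  obtains w \<phi> where "inj_on \<phi> (pverts G)" "w \<in> pverts H"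
    "{z. (w, z) \<in> parcs H} = \<phi> ` {z. (v, z) \<in> parcs G}"
proof -
  from iso obtain h where h: "pre_digraph.digraph_isomorphism (with_proj G) h"
    and H: "with_proj H = app_iso h (with_proj G)" by (auto simp: digraph_iso_def)
  define \<phi> where "\<phi> = iso_verts h"
  have verts: "pverts H = \<phi> ` pverts G" and arcs: "parcs H = iso_arcs h ` parcs G"
    and ends: "iso_tail h = fst" "iso_head h = snd"
    using H by (auto simp: with_proj_def app_iso_def \<phi>_def)
  have wf: "pair_wf_digraph G" and inj: "inj_on \<phi> (pverts G)"
    and arc: "\<And>a. a \<in> parcs G \<Longrightarrow> iso_arcs h a = (\<phi> (fst a), \<phi> (snd a))"
    using h ends
    by (auto simp: pre_digraph.digraph_isomorphism_def wf_digraph_wp_iff \<phi>_def prod_eq_iff)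
  have "{z. (\<phi> v, z) \<in> parcs H} = \<phi> ` {z. (v, z) \<in> parcs G}"
  proof (intro subset_antisym subsetI)
    fix z assume "z \<in> {z. (\<phi> v, z) \<in> parcs H}"
    then obtain a b where ab: "(a, b) \<in> parcs G" "(\<phi> v, z) = (\<phi> a, \<phi> b)"
      using arcs arc by fastforce
    then have "a = v" using inj v wf by (auto dest: inj_onD[OF inj] pair_wf_digraph.in_arcsD1)
    then show "z \<in> \<phi> ` {z. (v, z) \<in> parcs G}" using ab by auto
  next
    fix z assume "z \<in> \<phi> ` {z. (v, z) \<in> parcs G}"
    then obtain b where "(v, b) \<in> parcs G" "z = \<phi> b" by auto
    then show "z \<in> {z. (\<phi> v, z) \<in> parcs H}" using arcs arc[of "(v, b)"] by force
  qed
  with that inj verts v show thesis by blast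
qed

section \<open>Similarity of matrices indexed by vertices\<close>

lemma sum_nth_set:
  fixes f :: "'a \<Rightarrow> 'b::comm_monoid_add"
  assumes "distinct xs"
  shows "(\<Sum>i\<in>{0..<length xs}. f (xs ! i)) = (\<Sum>x\<in>set xs. f x)"
  by (rule sum.reindex_bij_betw) (use assms in \<open>auto intro!: bij_betw_nth\<close>)

text \<open>The transition matrix takes its rows from \<open>xs\<close> and its columns from
  \<open>ys\<close>, which absorbs the change of enumeration without a separate permutation matrix.
  Its inverse is the same \<open>p\<close> with the two lists exchanged.\<close>

lemma similar_mat_intertwined:
  fixes a b p :: "'a \<Rightarrow> 'a \<Rightarrow> real"
  assumes xs: "distinct xs" and ys: "distinct ys" and eq: "set xs = set ys"
    and inv: "\<And>x z. x \<in> set xs \<Longrightarrow> z \<in> set xs \<Longrightarrow>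
      (\<Sum>y\<in>set xs. p x y * p y z) = (if x = z then 1 else 0)"
    and comm: "\<And>x z. x \<in> set xs \<Longrightarrow> z \<in> set xs \<Longrightarrow>
      (\<Sum>y\<in>set xs. a x y * p y z) = (\<Sum>y\<in>set xs. p x y * b y z)"
  shows "similar_mat (mat (length xs) (length xs) (\<lambda>(i, j). a (xs ! i) (xs ! j)))
    (mat (length ys) (length ys) (\<lambda>(i, j). b (ys ! i) (ys ! j)))"
proof -
  define n where "n = length xs"
  have len: "length ys = n" using distinct_card[OF xs] distinct_card[OF ys] eq by (simp add: n_def)
  define M where "M f us vs = mat n n (\<lambda>(i, j). f (us ! i) (vs ! j) :: real)"
    for f and us vs :: "'a list"
  have M_carrier: "M f us vs \<in> carrier_mat n n" for f us vs by (simp add: M_def)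
  have mult: "M f us vs * M g vs ws = M (\<lambda>x z. \<Sum>y\<in>set xs. f x y * g y z) us ws"
    if "distinct vs" "set vs = set xs" "length vs = n" for f g us vs ws
    using sum_nth_set[OF that(1)] that(2,3)
    by (intro eq_matI) (auto simp: M_def scalar_prod_def)
  have cong: "M f us vs = M g us vs"
    if "\<And>x y. x \<in> set xs \<Longrightarrow> y \<in> set xs \<Longrightarrow> f x y = g x y"
      "set us = set xs" "set vs = set xs" "length us = n" "length vs = n" for f g us vs
  proof -
    have "us ! i \<in> set xs" "vs ! i \<in> set xs" if "i < n" for i
      using that \<open>set us = set xs\<close> \<open>set vs = set xs\<close> \<open>length us = n\<close> \<open>length vs = n\<close>
      by (metis nth_mem)+
    then show ?thesis using that(1) by (auto simp: M_def intro!: eq_matI)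
  qed
  have one: "M (\<lambda>x z. if x = z then 1 else 0) us us = 1\<^sub>m n" if "distinct us" "length us = n" for us
    using that by (intro eq_matI) (auto simp: M_def nth_eq_iff_index_eq)
  let ?A = "M a xs xs" and ?B = "M b ys ys" and ?P = "M p xs ys" and ?Q = "M p ys xs"
  have lens: "length xs = n" by (simp add: n_def)
  have PQ: "?P * ?Q = 1\<^sub>m n"
    unfolding mult[OF ys eq[symmetric] len] one[OF xs lens, symmetric]
    by (rule cong) (simp_all add: inv lens)
  have QP: "?Q * ?P = 1\<^sub>m n"
    unfolding mult[OF xs refl lens] one[OF ys len, symmetric]
    by (rule cong) (simp_all add: inv eq[symmetric] len)
  have "?A * ?P = ?P * ?B"
    unfolding mult[OF xs refl lens] mult[OF ys eq[symmetric] len]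
    by (rule cong) (simp_all add: comm eq[symmetric] lens len)
  then have "?P * ?B * ?Q = ?A * (?P * ?Q)"
    using assoc_mult_mat[OF M_carrier M_carrier M_carrier, of a xs xs p xs ys p ys xs] by simp
  also have "\<dots> = ?A" by (simp add: PQ right_mult_one_mat[OF M_carrier])
  finally have "?A = ?P * ?B * ?Q" ..
  from similar_matI[OF _ PQ QP this] have "similar_mat ?A ?B" by (simp add: M_carrier)
  then show ?thesis by (simp add: M_def len lens)
qed

lemma spectrum_mset_similar:
  assumes "similar_mat A B"
  shows "spectrum_mset A = spectrum_mset B"
proof -
  from similar_matD[OF assms] obtain n where "A \<in> carrier_mat n n" "B \<in> carrier_mat n n" by blast
  then show ?thesis
    using char_poly_similar[OF assms]
    by (simp add: spectrum_mset_def of_real_hom.char_poly_hom)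
qed


section \<open>The conjugating involution\<close>

text \<open>
  The signs are chosen so that the involution maps the eigenvector \<open>e1 - e2\<close> of the first graph to \<open>e3 - e4\<close>, an eigenvector of the second.
\<close>

definition cousin_matrix :: "vertex \<Rightarrow> vertex \<Rightarrow> real" where
  "cousin_matrix x y =
     (if x \<in> {V1, V2, V3, V4} \<and> y \<in> {V1, V2, V3, V4}
      then if (x, y) \<in> {(V1, V4), (V4, V1), (V2, V3), (V3, V2)} then - 1 / 2 else 1 / 2
      else if x = y then 1 else 0)"

lemma cousin_matrix_commute: "cousin_matrix x y = cousin_matrix y x"
  by (auto simp: cousin_matrix_def)

text \<open>The matrix is block diagonal, with an identity block outside the four vertices. The
  explicit four-term form lets later matrix identities be checked by cases on the vertices.\<close>

lemma sum_cousin_matrix: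
  assumes "finite V" "{V1, V2, V3, V4} \<subseteq> V" "x \<in> V"
  shows "(\<Sum>y\<in>V. cousin_matrix x y * h y) =
    (case x of
       V1 \<Rightarrow> (h V1 + h V2 + h V3 - h V4) / 2
     | V2 \<Rightarrow> (h V1 + h V2 - h V3 + h V4) / 2
     | V3 \<Rightarrow> (h V1 - h V2 + h V3 + h V4) / 2
     | V4 \<Rightarrow> (- h V1 + h V2 + h V3 + h V4) / 2
     | _ \<Rightarrow> h x)"
proof (cases "x \<in> {V1, V2, V3, V4}")
  case True
  then have "(\<Sum>y\<in>V. cousin_matrix x y * h y) = (\<Sum>y\<in>{V1, V2, V3, V4}. cousin_matrix x y * h y)"
    using assms by (intro sum.mono_neutral_right) (auto simp: cousin_matrix_def)
  then show ?thesis using True by (auto simp: cousin_matrix_def field_simps)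
next
  case False
  then have "(\<Sum>y\<in>V. cousin_matrix x y * h y) = (\<Sum>y\<in>V. if x = y then h y else 0)"
    by (intro sum.cong) (auto simp: cousin_matrix_def)
  then show ?thesis using False assms by (auto split: vertex.split)
qed

lemma sum_cousin_matrix_right:
  assumes "finite V" "{V1, V2, V3, V4} \<subseteq> V" "x \<in> V"
  shows "(\<Sum>y\<in>V. h y * cousin_matrix y x) =
    (case x of
       V1 \<Rightarrow> (h V1 + h V2 + h V3 - h V4) / 2
     | V2 \<Rightarrow> (h V1 + h V2 - h V3 + h V4) / 2
     | V3 \<Rightarrow> (h V1 - h V2 + h V3 + h V4) / 2
     | V4 \<Rightarrow> (- h V1 + h V2 + h V3 + h V4) / 2
     | _ \<Rightarrow> h x)"
  using sum_cousin_matrix[OF assms, of h] by (simp add: mult.commute cousin_matrix_commute)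

text \<open>The nontrivial block is half a symmetric Hadamard matrix of order 4: each row has one
  minus sign, in a different column for each row, so distinct rows are orthogonal.\<close>

lemma cousin_matrix_involution:
  assumes "finite V" "{V1, V2, V3, V4} \<subseteq> V" "x \<in> V"
  shows "(\<Sum>y\<in>V. cousin_matrix x y * cousin_matrix y z) = (if x = z then 1 else 0)"
  unfolding sum_cousin_matrix[OF assms]
  by (cases x) (auto simp: cousin_matrix_def)

text \<open>Indexing by vertices instead of positions gives the form that
  \<open>similar_mat_intertwined\<close> expects.\<close>

definition laplacian_entry :: "'a pair_pre_digraph \<Rightarrow> 'a \<Rightarrow> 'a \<Rightarrow> real" where
  "laplacian_entry G x y =
     (if x = y then real (transmission G x) else 0) - real (graph_dist G x y)"

lemma dist_laplacian_eq:
  assumes "distinct ws"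
  shows "dist_laplacian G ws =
    mat (length ws) (length ws) (\<lambda>(i, j). laplacian_entry G (ws ! i) (ws ! j))"
  using assms
  by (intro eq_matI)
    (auto simp: dist_laplacian_def dist_matrix_def mat_diag_def laplacian_entry_def
      nth_eq_iff_index_eq)

section \<open>The two graphs: arcs, sides and distances\<close>

abbreviation "B13 k \<equiv> add_edge (B_graph k) V1 V3"
abbreviation "B24 k \<equiv> add_edge (B_graph k) V2 V4"

lemma pverts_B [simp]: "pverts (add_edge (B_graph k) x y) = pverts (B_graph k)"
  by (simp add: add_edge_def)

lemma pverts_B_graph:
  "pverts (B_graph k) = {V0, V1, V2, V3, V4} \<union> L_verts k \<union> R_verts k"
  by (simp add: B_graph_def)

lemma finite_pverts_B_graph [simp]: "finite (pverts (B_graph k))"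
  by (simp add: pverts_B_graph L_verts_def R_verts_def)

lemma cousins_subset: "{V1, V2, V3, V4} \<subseteq> pverts (B_graph k)"
  by (simp add: pverts_B_graph)

lemma sum_pverts_B_graph:
  "(\<Sum>w\<in>pverts (B_graph k). f w) =
    f V0 + f V1 + f V2 + f V3 + f V4 + (\<Sum>i<k. f (VL i)) + (\<Sum>i<k + 1. f (VR i))"
proof -
  have "sum f ({V0, V1, V2, V3, V4} \<union> VL ` {..<k} \<union> VR ` {..<k + 1}) =
    sum f ({V0, V1, V2, V3, V4} \<union> VL ` {..<k}) + sum f (VR ` {..<k + 1})"
    by (rule sum.union_disjoint) auto
  also have "sum f ({V0, V1, V2, V3, V4} \<union> VL ` {..<k}) =
    sum f {V0, V1, V2, V3, V4} + sum f (VL ` {..<k})"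
    by (rule sum.union_disjoint) auto
  finally show ?thesis
    unfolding pverts_B_graph L_verts_def R_verts_def
    by (simp add: sum.reindex inj_on_def add.assoc)
qed

lemma L_verts_iff [simp]:
  "VL i \<in> L_verts k \<longleftrightarrow> i < k" "VR i \<notin> L_verts k" "V0 \<notin> L_verts k" "V1 \<notin> L_verts k"
  "V2 \<notin> L_verts k" "V3 \<notin> L_verts k" "V4 \<notin> L_verts k"
  by (auto simp: L_verts_def)

lemma R_verts_iff [simp]:
  "VR i \<in> R_verts k \<longleftrightarrow> i < k + 1" "VL i \<notin> R_verts k" "V0 \<notin> R_verts k" "V1 \<notin> R_verts k"
  "V2 \<notin> R_verts k" "V3 \<notin> R_verts k" "V4 \<notin> R_verts k"
  by (auto simp: R_verts_def)

text \<open>One orientation of each edge, before symmetric closure, as a disjunction that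
  simplification decides once both vertices are constructors.\<close>

definition B_edge :: "nat \<Rightarrow> vertex \<Rightarrow> vertex \<Rightarrow> bool" where
  "B_edge k a b \<longleftrightarrow> a = V0 \<and> (b = V1 \<or> b = V2 \<or> b \<in> L_verts k) \<or> a = V2 \<and> b = V3
     \<or> a \<in> R_verts k \<and> (b = V0 \<or> b = V3 \<or> b = V4)"

lemma mem_symcl: "(a, b) \<in> symcl R \<longleftrightarrow> (a, b) \<in> R \<or> (b, a) \<in> R"
  by (force simp: symcl_def)

lemma mem_parcs_B:
  "(a, b) \<in> parcs (add_edge (B_graph k) x y) \<longleftrightarrow>
    a = x \<and> b = y \<or> a = y \<and> b = x \<or> B_edge k a b \<or> B_edge k b a"
proof -
  let ?E = "{(V0, V1), (V0, V2), (V2, V3)} \<union> {V0} \<times> L_verts k \<union> R_verts k \<times> {V0, V3, V4}"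
  have "B_edge k u v \<longleftrightarrow> (u, v) \<in> ?E" for u v
    unfolding B_edge_def by blast
  moreover have "(a, b) \<in> symcl ?E \<longleftrightarrow> (a, b) \<in> ?E \<or> (b, a) \<in> ?E"
    by (rule mem_symcl)
  ultimately have "(a, b) \<in> symcl ?E \<longleftrightarrow> B_edge k a b \<or> B_edge k b a" by simp
  then show ?thesis
    unfolding add_edge_def B_graph_def pair_pre_digraph.simps Un_iff by simp blast
qed

lemma B_edge_cross: "B_edge k a b \<Longrightarrow> a \<in> {V0, V3, V4} \<longleftrightarrow> b \<notin> {V0, V3, V4}"
  unfolding B_edge_def by (elim disjE conjE) auto

lemma B_edge_pverts: "B_edge k a b \<Longrightarrow> a \<in> pverts (B_graph k) \<and> b \<in> pverts (B_graph k)"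
  unfolding B_edge_def pverts_B_graph by (elim disjE conjE) simp_all

text \<open>The distance formula of \<open>dominating_edge_dist\<close> for the side
  \<open>{V0, V3, V4}\<close>.\<close>

definition B_dist :: "vertex pair_pre_digraph \<Rightarrow> vertex \<Rightarrow> vertex \<Rightarrow> nat" where
  "B_dist G u v = (if u = v then 0 else if (u, v) \<in> parcs G then 1
     else if u \<in> {V0, V3, V4} \<longleftrightarrow> v \<in> {V0, V3, V4} then 2 else 3)"

text \<open>The hypothesis on \<open>(x, y)\<close> treats both graphs at once: either added edge
  crosses between the sides, as every edge of \<open>B_graph k\<close> does.\<close>

lemma parcs_B_cross:
  assumes "(x, y) \<in> {(V1, V3), (V2, V4)}"
    and "(a, b) \<in> parcs (add_edge (B_graph k) x y)"
  shows "a \<in> {V0, V3, V4} \<longleftrightarrow> b \<notin> {V0, V3, V4}"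
  using assms B_edge_cross[of k a b] B_edge_cross[of k b a] unfolding mem_parcs_B by auto

lemma pair_graph_B:
  assumes "(x, y) \<in> {(V1, V3), (V2, V4)}"
  shows "pair_graph (add_edge (B_graph k) x y)"
proof -
  let ?G = "add_edge (B_graph k) x y"
  have sub: "parcs ?G \<subseteq> pverts (B_graph k) \<times> pverts (B_graph k)"
  proof (rule subrelI)
    fix a b assume "(a, b) \<in> parcs ?G"
    moreover have "x \<in> pverts (B_graph k)" "y \<in> pverts (B_graph k)"
      using assms by (auto simp: pverts_B_graph)
    ultimately show "(a, b) \<in> pverts (B_graph k) \<times> pverts (B_graph k)"
      unfolding mem_parcs_B by (auto dest: B_edge_pverts)
  qed
  have "sym (parcs ?G)"
    by (auto simp: sym_def mem_parcs_B)
  moreover have "finite (parcs ?G)" using sub by (rule finite_subset) simp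
  \<comment> \<open>There are no loops because the ends of an arc lie on opposite sides.\<close>
  moreover have "fst e \<noteq> snd e" if "e \<in> parcs ?G" for e
    using parcs_B_cross[OF assms, of "fst e" "snd e" k] that by (metis prod.collapse)
  ultimately show ?thesis
    using sub by unfold_locales (auto simp: symmetric_def)
qed

lemma B_graph_dist:
  assumes "(x, y) \<in> {(V1, V3), (V2, V4)}"
  shows "connected (with_proj (add_edge (B_graph k) x y))"
    and "\<lbrakk>u \<in> pverts (B_graph k); v \<in> pverts (B_graph k)\<rbrakk> \<Longrightarrow>
      graph_dist (add_edge (B_graph k) x y) u v =
      B_dist (add_edge (B_graph k) x y) u v"
proof -
  let ?G = "add_edge (B_graph k) x y"
  interpret pair_graph ?G by (rule pair_graph_B[OF assms])
  have dom: "(V0, b) \<in> parcs ?G" if "b \<in> pverts ?G" "b \<notin> {V0, V3, V4}" for b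
    using that by (auto simp: mem_parcs_B B_edge_def pverts_B_graph)
  \<comment> \<open>The dominating edge is \<open>V0\<close> to \<open>VR 0\<close>; the latter
    exists since \<open>R\<close> has \<open>k + 1\<close> elements.\<close>
  have dom': "(VR 0, a) \<in> parcs ?G" if "a \<in> {V0, V3, V4}" for a
    using that by (auto simp: mem_parcs_B B_edge_def)
  show "connected (with_proj ?G)"
    by (rule dominating_edge_connected[of "{V0, V3, V4}" V0 "VR 0" "B_dist ?G"])
      (use parcs_B_cross[OF assms] dom dom' in \<open>auto simp: B_dist_def pverts_B_graph\<close>)
  show "graph_dist ?G u v = B_dist ?G u v" if "u \<in> pverts (B_graph k)" "v \<in> pverts (B_graph k)"
    by (rule dominating_edge_dist(2)[of "{V0, V3, V4}" V0 "VR 0" "B_dist ?G"])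
      (use parcs_B_cross[OF assms] dom dom' that in \<open>auto simp: B_dist_def\<close>)
qed

lemma bipartite_B:
  assumes "(x, y) \<in> {(V1, V3), (V2, V4)}"
  shows "bipartite (add_edge (B_graph k) x y)"
proof -
  interpret pair_graph "add_edge (B_graph k) x y" by (rule pair_graph_B[OF assms])
  show ?thesis
    unfolding bipartite_def
    by (rule exI[of _ "{V0, V3, V4}"], rule exI[of _ "pverts (B_graph k) - {V0, V3, V4}"])
      (use parcs_B_cross[OF assms] in_arcsD1 in_arcsD2 in \<open>fastforce simp: pverts_B_graph\<close>)
qed

section \<open>Transmissions and the intertwining relation\<close>

text \<open>Distinct vertices of \<open>L\<close> are at distance 2, and so are distinct vertices of
  \<open>R\<close>; this is what such a vertex's own class contributes to its transmission.\<close>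

lemma sum_two_off_diagonal:
  assumes "i < (k::nat)"
  shows "(\<Sum>j<k. if i = j then 0 else 2) = 2 * real k - 2"
proof -
  have "(\<Sum>j<k. if i = j then 0 else 2) = (\<Sum>j<k. 2 - (if i = j then 2 else 0 :: real))"
    by (rule sum.cong) auto
  also have "\<dots> = 2 * real k - 2" using assms by (simp add: sum_subtractf)
  finally show ?thesis .
qed

text \<open>Distances depend only on sides and adjacency, so a vertex of degree \<open>d\<close> has
  transmission \<open>6 * k + 13 - 2 * d\<close> on the side \<open>{V0, V3, V4}\<close> and
  \<open>4 * k + 13 - 2 * d\<close> on the other.\<close>

lemma transmission_B13:
  assumes "v \<in> pverts (B_graph k)"
  shows "real (transmission (B13 k) v) =
    (case v of V0 \<Rightarrow> 2 * k + 7 | V1 \<Rightarrow> 4 * k + 9 | V2 \<Rightarrow> 4 * k + 9 | V3 \<Rightarrow> 4 * k + 7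
     | V4 \<Rightarrow> 4 * k + 11 | VL i \<Rightarrow> 4 * k + 11 | VR i \<Rightarrow> 4 * k + 7)"
proof -
  have "real (transmission (B13 k) v) = (\<Sum>w\<in>pverts (B_graph k). real (B_dist (B13 k) v w))"
    unfolding transmission_def using B_graph_dist(2)[of V1 V3 v k] assms by simp
  \<comment> \<open>Removing \<open>sum.lessThan_Suc\<close> keeps the sum over \<open>R\<close>
    whole, so that \<open>sum_two_off_diagonal\<close> applies to its \<open>k + 1\<close>
    terms.\<close>
  then show ?thesis using assms unfolding sum_pverts_B_graph
    by (cases v) (simp_all add: B_dist_def mem_parcs_B B_edge_def pverts_B_graph
      if_distrib[of real] sum_two_off_diagonal del: sum.lessThan_Suc cong: sum.cong_simp if_cong)
qed

text \<open>On \<open>V1\<close> to \<open>V4\<close> the values are those of \<open>B13 k\<close>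
  in another order; at all other vertices they are unchanged.\<close>

lemma transmission_B24:
  assumes "v \<in> pverts (B_graph k)"
  shows "real (transmission (B24 k) v) =
    (case v of V0 \<Rightarrow> 2 * k + 7 | V1 \<Rightarrow> 4 * k + 11 | V2 \<Rightarrow> 4 * k + 7 | V3 \<Rightarrow> 4 * k + 9
     | V4 \<Rightarrow> 4 * k + 9 | VL i \<Rightarrow> 4 * k + 11 | VR i \<Rightarrow> 4 * k + 7)"
proof -
  have "real (transmission (B24 k) v) = (\<Sum>w\<in>pverts (B_graph k). real (B_dist (B24 k) v w))"
    unfolding transmission_def using B_graph_dist(2)[of V2 V4 v k] assms by simp
  then show ?thesis using assms unfolding sum_pverts_B_graph
    by (cases v) (simp_all add: B_dist_def mem_parcs_B B_edge_def pverts_B_graph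
      if_distrib[of real] sum_two_off_diagonal del: sum.lessThan_Suc cong: sum.cong_simp if_cong)
qed

text \<open>In both graphs a vertex outside \<open>V1\<close> to \<open>V4\<close> is equidistant
  from \<open>V1\<close> and \<open>V2\<close>, and from \<open>V3\<close> and \<open>V4\<close>.
  Vectors of shape \<open>(a, a, b, b)\<close> are fixed by the involution, so the mixed entries
  agree. Entries away from the four vertices coincide, and a 4 by 4 identity remains.\<close>

lemma laplacian_intertwined:
  assumes x: "x \<in> pverts (B_graph k)" and z: "z \<in> pverts (B_graph k)"
  shows "(\<Sum>y\<in>pverts (B_graph k). laplacian_entry (B13 k) x y * cousin_matrix y z) =
    (\<Sum>y\<in>pverts (B_graph k). cousin_matrix x y * laplacian_entry (B24 k) y z)"
proof -
  note V = finite_pverts_B_graph[of k] cousins_subset[of k]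
  have l13: "laplacian_entry (B13 k) u v =
      (if u = v then real (transmission (B13 k) u) else 0) - real (B_dist (B13 k) u v)"
    and l24: "laplacian_entry (B24 k) u v =
      (if u = v then real (transmission (B24 k) u) else 0) - real (B_dist (B24 k) u v)"
    if "u \<in> pverts (B_graph k)" "v \<in> pverts (B_graph k)" for u v
    using B_graph_dist(2)[of V1 V3 u k v] B_graph_dist(2)[of V2 V4 u k v] that
    by (simp_all add: laplacian_entry_def)
  show ?thesis
    unfolding sum_cousin_matrix[OF V x] sum_cousin_matrix_right[OF V z]
    using x z V(2)
    by (cases x; cases z)
      (simp_all add: l13 l24 transmission_B13 transmission_B24 B_dist_def mem_parcs_B B_edge_def)
qed

section \<open>Non-isomorphism by degrees\<close>

lemma not_iso_B:
  assumes "k > 0"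
  shows "\<not> digraph_iso (with_proj (B13 k)) (with_proj (B24 k))"
proof
  assume iso: "digraph_iso (with_proj (B13 k)) (with_proj (B24 k))"
  have "V1 \<in> pverts (B13 k)" using cousins_subset by simp
  from digraph_iso_neighbours[OF iso this, unfolded pverts_B] obtain \<phi> w where
    inj: "inj_on \<phi> (pverts (B_graph k))" and w: "w \<in> pverts (B_graph k)"
    and nb: "{z. (w, z) \<in> parcs (B24 k)} = \<phi> ` {z. (V1, z) \<in> parcs (B13 k)}"
    by metis
  have "(V1, z) \<in> parcs (B13 k) \<longleftrightarrow> z \<in> {V0, V3}" for z
    by (cases z) (simp_all add: mem_parcs_B B_edge_def)
  then have "{z. (V1, z) \<in> parcs (B13 k)} = {V0, V3}" by blast
  with nb have "{z. (w, z) \<in> parcs (B24 k)} = {\<phi> V0, \<phi> V3}" by simp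
  then have mem: "(w, z) \<in> parcs (B24 k) \<longleftrightarrow> z = \<phi> V0 \<or> z = \<phi> V3" for z by blast
  have ne: "\<phi> V0 \<noteq> \<phi> V3" using inj_onD[OF inj, of V0 V3] by (auto simp: pverts_B_graph)
  \<comment> \<open>\<open>no3\<close> and \<open>ab\<close> express without cardinalities that
    \<open>w\<close>, the image of \<open>V1\<close>, has at most and at least two
    neighbours.\<close>
  have no3: "a = b \<or> b = c \<or> a = c"
    if "(w, a) \<in> parcs (B24 k)" "(w, b) \<in> parcs (B24 k)" "(w, c) \<in> parcs (B24 k)" for a b c
    using that unfolding mem by auto
  have "(w, \<phi> V0) \<in> parcs (B24 k)" "(w, \<phi> V3) \<in> parcs (B24 k)" by (simp_all add: mem)
  with ne obtain a b where ab: "(w, a) \<in> parcs (B24 k)" "(w, b) \<in> parcs (B24 k)" "a \<noteq> b" by blast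
  show False
  proof (cases w)
    case V0
    then show False using no3[of V1 V2 "VR 0"] by (simp add: mem_parcs_B B_edge_def)
  next
    case V2
    then show False using no3[of V0 V3 V4] by (simp add: mem_parcs_B B_edge_def)
  next
    case V3
    \<comment> \<open>\<open>VR 1\<close> exists because \<open>k > 0\<close>; this is where
      positivity of \<open>k\<close> enters.\<close>
    then show False using no3[of V2 "VR 0" "VR 1"] assms by (simp add: mem_parcs_B B_edge_def)
  next
    case V4
    then show False using no3[of V2 "VR 0" "VR 1"] assms by (simp add: mem_parcs_B B_edge_def)
  next
    case (VR i)
    then show False using no3[of V0 V3 V4] w by (auto simp: mem_parcs_B B_edge_def pverts_B_graph)
  \<comment> \<open>The remaining cases \<open>V1\<close> and \<open>VL i\<close> are leaves
    attached to \<open>V0\<close>.\<close>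
  qed (use ab in \<open>simp_all add: mem_parcs_B B_edge_def\<close>)
qed

theorem theorem3p13:
  fixes k :: nat
  assumes "k > 0"
  shows "DL_cospectral (add_edge (B_graph k) V1 V3) (add_edge (B_graph k) V2 V4)
    \<and> bipartite (add_edge (B_graph k) V1 V3)
    \<and> bipartite (add_edge (B_graph k) V2 V4)"
proof -
  have "spectrum_mset (dist_laplacian (B13 k) ws) = spectrum_mset (dist_laplacian (B24 k) us)"
    if "vertex_enum (B13 k) ws" "vertex_enum (B24 k) us" for ws us
  proof -
    have ws: "distinct ws" "set ws = pverts (B_graph k)"
      and us: "distinct us" "set us = pverts (B_graph k)"
      using that by (auto simp: vertex_enum_def)
    have "similar_mat (dist_laplacian (B13 k) ws) (dist_laplacian (B24 k) us)"
      unfolding dist_laplacian_eq[OF ws(1)] dist_laplacian_eq[OF us(1)]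
    \<comment> \<open>The two enumerations may order the vertices differently; only their common
      vertex set matters.\<close>
    proof (rule similar_mat_intertwined[OF ws(1) us(1), of cousin_matrix, unfolded ws us])
      fix x z assume "x \<in> pverts (B_graph k)" "z \<in> pverts (B_graph k)"
      then show "(\<Sum>y\<in>pverts (B_graph k). cousin_matrix x y * cousin_matrix y z) =
          (if x = z then 1 else 0)"
        by (intro cousin_matrix_involution finite_pverts_B_graph cousins_subset)
    qed (auto intro: laplacian_intertwined)
    then show ?thesis by (rule spectrum_mset_similar)
  qed
  then show ?thesis
    using pair_graph_B[of V1 V3 k] pair_graph_B[of V2 V4 k]
      B_graph_dist(1)[of V1 V3 k] B_graph_dist(1)[of V2 V4 k]
      bipartite_B[of V1 V3 k] bipartite_B[of V2 V4 k] not_iso_B[OF assms]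
    by (simp add: DL_cospectral_def)
qed

end
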